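(* For every integer $k\ge 3$, the set $\{N: N \text{ is a GA1 number and } \Omega(N)=k\}$ is finite.
   Context: For an integer $n>1$ let $G(n)=\dfrac{\sigma(n)}{n\log\log n}$, where $\sigma(n)=\sum_{d\mid n}d$. A GA1 number is a composite integer $N$ such that $G(N)\ge G(N/p)$ for every prime $p$ dividing $N$. $\Omega(n)$ is the number of prime factors of $n$ counted with multiplicity. *)

theory Defs
  imports Complex_Main "HOL-Computational_Algebra.Primes"
begin

definition sigma :: "nat \<Rightarrow> nat" where
  "sigma n = (\<Sum>d | d dvd n. d)"

text \<open>
  Only meaningful for \<open>n > 1\<close>. There the denominator is nonzero, since \<open>ln n \<noteq> 1\<close>; it is negative
  exactly for \<open>n = 2\<close>.
\<close>
definition G :: "nat \<Rightarrow> real" where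
  "G n = real (sigma n) / (real n * ln (ln (real n)))"

definition bigOmega :: "nat \<Rightarrow> nat" where
  "bigOmega n = size (prime_factorization n)"

text \<open>
  Since \<open>N\<close> is composite, \<open>N div p\<close> is exact and exceeds 1 for every prime divisor \<open>p\<close>, so
  \<open>G\<close> is only evaluated where it is meaningful.
\<close>
definition GA1 :: "nat \<Rightarrow> bool" where
  "GA1 N \<longleftrightarrow> N > 1 \<and> \<not> prime N \<and> (\<forall>p. prime p \<and> p dvd N \<longrightarrow> G N \<ge> G (N div p))"

end

theory Submission
  imports Defs
begin

text \<open>
  Let \<open>p\<close> be the largest prime factor of \<open>N\<close> and \<open>M = N / p\<close>. Since
  \<open>\<sigma>(N) \<le> (p + 1) \<sigma>(M)\<close>, the GA1 inequality at \<open>p\<close> forces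
  \<open>ln ln N - ln ln M \<le> (ln ln M) / p\<close>; here \<open>k \<ge> 3\<close> is needed, because it gives
  \<open>M \<ge> 4\<close> and so \<open>ln ln M > 0\<close>. On the other hand \<open>N \<le> p ^ k\<close>, so
  \<open>ln ln N - ln ln M \<ge> ln p / ln N \<ge> 1 / k\<close>. Hence
  \<open>p \<le> k ln ln M \<le> k ln (k ln p)\<close>, which bounds \<open>p\<close> and then \<open>N\<close>.
\<close>

text \<open>A divisor of \<open>p * M\<close> that is prime to \<open>p\<close> divides
  \<open>M\<close>; any other is \<open>p\<close> times a divisor of \<open>M\<close>. The two
  families overlap when \<open>p\<close> divides \<open>M\<close>, hence only an inequality.\<close>

lemma sigma_prime_mult_le:
  assumes "prime p" "M > 0"
  shows "sigma (p * M) \<le> (p + 1) * sigma M"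
proof -
  have sub: "{d. d dvd p * M} \<subseteq> {d. d dvd M} \<union> (*) p ` {d. d dvd M}"
  proof
    fix d assume "d \<in> {d. d dvd p * M}"
    hence d: "d dvd p * M" by simp
    show "d \<in> {d. d dvd M} \<union> (*) p ` {d. d dvd M}"
    proof (cases "p dvd d")
      case True
      then obtain e where e: "d = p * e" by (elim dvdE)
      with d assms(1) have "e dvd M" by (auto dest: prime_gt_0_nat)
      with e show ?thesis by auto
    next
      case False
      with assms(1) have "coprime d p"
        using prime_imp_coprime coprime_commute by blast
      with d show ?thesis by (simp add: coprime_dvd_mult_right_iff)
    qed
  qed
  have fin: "finite {d. d dvd M}" using assms(2) by simp
  have "sigma (p * M) \<le> \<Sum>({d. d dvd M} \<union> (*) p ` {d. d dvd M})"
    unfolding sigma_def using fin sub by (intro sum_mono2) auto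
  also have "\<dots> \<le> \<Sum>{d. d dvd M} + \<Sum>((*) p ` {d. d dvd M})"
    using fin by (simp add: sum_Un_nat)
  also have "\<Sum>((*) p ` {d. d dvd M}) = p * \<Sum>{d. d dvd M}"
    using assms(1) by (subst sum.reindex)
      (auto simp: inj_on_def sum_distrib_left dest: prime_gt_0_nat)
  finally show ?thesis by (simp add: sigma_def)
qed

lemma prod_mset_le_power:
  fixes A :: "nat multiset"
  assumes "\<And>x. x \<in># A \<Longrightarrow> x \<le> b"
  shows "prod_mset A \<le> b ^ size A"
  using assms by (induction A) (auto intro!: mult_mono)

lemma power_le_prod_mset:
  fixes A :: "nat multiset"
  assumes "\<And>x. x \<in># A \<Longrightarrow> b \<le> x"
  shows "b ^ size A \<le> prod_mset A"
  using assms by (induction A) (auto intro!: mult_mono)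

lemma two_power_bigOmega_le:
  assumes "N > 0"
  shows "2 ^ bigOmega N \<le> N"
  using assms power_le_prod_mset[of "prime_factorization N" 2]
  by (simp add: bigOmega_def in_prime_factors_iff prime_ge_2_nat prod_mset_prime_factorization_nat)

lemma bigOmega_prime_mult:
  assumes "prime p" "M > 0"
  shows "bigOmega (p * M) = Suc (bigOmega M)"
  using assms by (auto simp: bigOmega_def prime_factorization_mult prime_factorization_prime)

lemma sigma_pos: "M > 0 \<Longrightarrow> sigma M > 0"
  unfolding sigma_def by (intro sum_pos2[of _ M]) auto

text \<open>The threshold 4 is what a cofactor \<open>M\<close> with at least two prime factors
  satisfies.\<close>

lemma ln_ln_pos:
  assumes "n \<ge> (4::nat)"
  shows "ln (ln (real n)) > 0"
proof -
  have "exp 1 < real n" using exp_le assms by linarith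
  hence "ln (exp 1) < ln (real n)" using assms by (subst ln_less_cancel_iff) auto
  thus ?thesis by simp
qed

text \<open>Scaling by \<open>2 * k\<close> inside the logarithm makes \<open>k * ln x\<close> cost
  only \<open>x / 2\<close> plus a constant, and \<open>x / 2\<close> is absorbed on the
  left.\<close>

lemma le_mult_ln_imp_bounded:
  fixes x k :: real
  assumes "x > 0" "k > 0" "x \<le> k * (ln k + ln x)"
  shows "x \<le> 2 * k * (ln k + ln (2 * k))"
proof -
  have "ln x = ln (x / (2 * k)) + ln (2 * k)"
    using assms by (simp add: ln_div ln_mult)
  also have "ln (x / (2 * k)) \<le> x / (2 * k)"
    using assms by (intro ln_bound) auto
  finally have "k * ln x \<le> k * (x / (2 * k) + ln (2 * k))"
    using assms by (intro mult_left_mono) auto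
  also have "\<dots> = x / 2 + k * ln (2 * k)"
    using assms by (simp add: field_simps)
  finally show ?thesis using assms(3) by (simp add: algebra_simps)
qed

lemma G_quotient_le_imp:
  assumes "prime p" "M \<ge> 4" "G M \<le> G (p * M)"
  shows "ln (real p) / ln (real (p * M)) \<le> ln (ln (real M)) / real p"
proof -
  define N where "N = p * M"
  have p: "p \<ge> 2" using assms(1) by (rule prime_ge_2_nat)
  have MN: "M \<le> N" using p by (simp add: N_def)
  have LM: "ln (ln (real M)) > 0" and LN: "ln (ln (real N)) > 0"
    using ln_ln_pos assms(2) MN by auto
  have lM: "ln (real M) > 0" and lN: "ln (real N) > 0" using assms(2) MN by auto
  have s: "real (sigma M) > 0" using sigma_pos assms(2) by simp
  have "real (sigma M) / (real M * ln (ln (real M))) \<le> real (sigma N) / (real N * ln (ln (real N)))"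
    using assms(3) by (simp add: G_def N_def)
  also have "\<dots> \<le> real ((p + 1) * sigma M) / (real N * ln (ln (real N)))"
  proof (rule divide_right_mono)
    show "real (sigma N) \<le> real ((p + 1) * sigma M)"
      unfolding of_nat_le_iff N_def using sigma_prime_mult_le assms by simp
  qed (use LN in simp)
  \<comment> \<open>Both sides are written with the positive factor \<open>sigma M / M\<close>,
    which then cancels, so that no divisor sum remains.\<close>
  finally have "real (sigma M) / real M * (1 / ln (ln (real M)))
      \<le> real (sigma M) / real M * ((real p + 1) / (real p * ln (ln (real N))))"
    by (simp add: N_def field_simps)
  hence "1 / ln (ln (real M)) \<le> (real p + 1) / (real p * ln (ln (real N)))"
    using s assms(2) by (subst (asm) mult_le_cancel_left_pos) auto
  hence "real p * ln (ln (real N)) \<le> (real p + 1) * ln (ln (real M))"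
    using LM LN p by (simp add: field_simps)
  hence "ln (ln (real N)) - ln (ln (real M)) \<le> ln (ln (real M)) / real p"
    using p by (simp add: field_simps)
  \<comment> \<open>This is \<open>ln t \<le> t - 1\<close> at \<open>t = ln M / ln N\<close>; since
    \<open>ln M = ln N - ln p\<close>, the right side is \<open>- ln p / ln N\<close>.\<close>
  moreover have "ln (ln (real M)) - ln (ln (real N)) \<le> ln (real M) / ln (real N) - 1"
    using lM lN ln_le_minus_one[of "ln (real M) / ln (real N)"] by (simp add: ln_div)
  moreover have "ln (real M) = ln (real N) - ln (real p)"
    using p assms(2) by (simp add: N_def ln_mult)
  hence "ln (real M) / ln (real N) = 1 - ln (real p) / ln (real N)"
    using lN by (simp add: field_simps)
  ultimately show ?thesis by (simp add: N_def)
qed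

text \<open>The bound on \<open>p\<close> involves \<open>k\<close> alone, so
  \<open>N \<le> p ^ k\<close> is bounded in terms of \<open>k\<close> as well.\<close>

lemma GA1_bounded:
  assumes "GA1 N" "bigOmega N = k" "k \<ge> 3"
  obtains p where "prime p" "N \<le> p ^ k" "real p \<le> 2 * real k * (ln (real k) + ln (2 * real k))"
proof -
  define p where "p = Max (prime_factors N)"
  have N: "N > 1" using assms(1) by (simp add: GA1_def)
  have "prime_factors N \<noteq> {}" using N by (auto simp: prime_factorization_empty_iff)
  hence pin: "p \<in> prime_factors N" unfolding p_def by (intro Max_in) auto
  hence p: "prime p" "p dvd N" by auto
  have p2: "p \<ge> 2" using p(1) by (rule prime_ge_2_nat)
  have Npk: "N \<le> p ^ k"
    using prod_mset_le_power[of "prime_factorization N" p] N assms(2)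
    by (simp add: p_def bigOmega_def prod_mset_prime_factorization_nat)
  obtain M where M: "N = p * M" using p(2) by (elim dvdE)
  have M0: "M > 0" using M N by (cases M) auto
  have "k = Suc (bigOmega M)" using bigOmega_prime_mult[OF p(1) M0] M assms(2) by simp
  \<comment> \<open>Removing one prime factor from at least three leaves at least two, each at least
    2.\<close>
  hence "(2::nat) ^ 2 \<le> 2 ^ bigOmega M" using assms(3) by (intro power_increasing) auto
  also have "\<dots> \<le> M" using two_power_bigOmega_le[OF M0] .
  finally have M4: "M \<ge> 4" by simp
  have "G M \<le> G (p * M)" using assms(1) p M p2 by (auto simp: GA1_def)
  from G_quotient_le_imp[OF p(1) M4 this]
  have key: "ln (real p) / ln (real N) \<le> ln (ln (real M)) / real p" by (simp add: M)
  have MN: "M \<le> N" using p2 by (simp add: M)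
  have lM: "ln (real M) > 0" and lN: "ln (real N) > 0" using M4 MN by auto
  have lp: "ln (real p) > 0" "ln (real p) \<le> real p" using p2 by (auto intro: ln_bound)
  have k0: "real k > 0" using assms(3) by simp
  have "real N \<le> real p ^ k" using Npk by (metis of_nat_le_iff of_nat_power)
  hence "ln (real N) \<le> ln (real p ^ k)" using N p2 by (subst ln_le_cancel_iff) auto
  also have "\<dots> = real k * ln (real p)" using p2 by (simp add: ln_realpow)
  finally have lNk: "ln (real N) \<le> real k * ln (real p)" .
  hence "1 / real k \<le> ln (real p) / ln (real N)"
    using lN k0 by (simp add: field_simps)
  with key have "1 / real k \<le> ln (ln (real M)) / real p" by linarith
  hence "real p \<le> real k * ln (ln (real M))" using k0 p2 by (simp add: field_simps)
  \<comment> \<open>The crude estimate \<open>ln p \<le> p\<close> is affordable here: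
    \<open>p\<close> still occurs only inside a logarithm on the right.\<close>
  also have "ln (ln (real M)) \<le> ln (real k * real p)"
  proof -
    have "ln (real M) \<le> ln (real N)" using M0 MN by simp
    also note lNk
    also have "real k * ln (real p) \<le> real k * real p" using k0 lp by simp
    finally show ?thesis using lM by simp
  qed
  also have "ln (real k * real p) = ln (real k) + ln (real p)"
    using k0 p2 by (simp add: ln_mult)
  finally have "real p \<le> real k * (ln (real k) + ln (real p))"
    using k0 by simp
  from le_mult_ln_imp_bounded[OF _ k0 this] p2 have
    "real p \<le> 2 * real k * (ln (real k) + ln (2 * real k))" by simp
  with p(1) Npk show ?thesis by (rule that)
qed

theorem theorem10:
  fixes k :: nat
  assumes "k \<ge> 3"
  shows "finite {N. GA1 N \<and> bigOmega N = k}"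
proof (rule finite_subset)
  \<comment> \<open>As \<open>p\<close> is an integer, its real bound may be rounded down.\<close>
  define B where "B = nat \<lfloor>2 * real k * (ln (real k) + ln (2 * real k))\<rfloor>"
  show "{N. GA1 N \<and> bigOmega N = k} \<subseteq> {..B ^ k}"
  proof
    fix N assume "N \<in> {N. GA1 N \<and> bigOmega N = k}"
    hence "GA1 N" "bigOmega N = k" by auto
    from GA1_bounded[OF this assms] obtain p
      where p: "N \<le> p ^ k" "real p \<le> 2 * real k * (ln (real k) + ln (2 * real k))" by blast
    from p(2) have "p \<le> B" unfolding B_def by (simp add: le_nat_floor)
    hence "p ^ k \<le> B ^ k" by (intro power_mono) auto
    with p(1) show "N \<in> {..B ^ k}" by simp
  qed
qed simp

end
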